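(* Let $(X_1,\dots,X_n)$ be distributed according to the $\mathcal{M}^{(a)}_{n,r}$-model, and let the function $a:\{0,1,\dots\}\to(0,+\infty)$ satisfy the condition $$\frac{C^{(a)}_{n,r-1}}{C^{(a)}_{n,r}}\sum_{h=1}^n\frac{x'_h+1}{r}\,\frac{a(x'_h+1)}{a(x'_h)}=1\qquad\text{for any }(x'_1,\dots,x'_n)\in A_{n,r-1}.$$ Then the occupancy vector $(X'_1,\dots,X'_n)$ obtained by applying the transformation $\mathcal{K}_1$ (dropping one of the $r$ particles uniformly at random) is distributed according to the $\mathcal{M}^{(a)}_{n,r-1}$-model.
   Context: For integers $n\ge1$, $r\ge0$, $A_{n,r}$ is the set of vectors $(x_1,\dots,x_n)$ of non-negative integers with $\sum_{j=1}^n x_j=r$; in the statement $n\ge2$, $r\ge1$. Given $a:\{0,1,2,\dots\}\to(0,+\infty)$, a random vector $(X_1,\dots,X_n)$ with values in $A_{n,r}$ is distributed according to the $\mathcal{M}^{(a)}_{n,r}$-model if $$P\{X_1=x_1,\dots,X_n=x_n\}=\frac{\prod_{j=1}^n a(x_j)}{C^{(a)}_{n,r}}\quad\text{for }(x_1,\dots,x_n)\in A_{n,r},\qquad C^{(a)}_{n,r}=\sum_{\xi\in A_{n,r}}\prod_{j=1}^n a(\xi_j).$$ $X_j$ is interpreted as the number of particles in cell $j$ when $r$ particles are distributed among $n$ cells. Transformation $\mathcal{K}_1$: one of the $r$ particles is dropped at random, each of the $r$ particles having the same probability $1/r$ of being dropped independently of its cell; $(X'_1,\dots,X'_n)$ are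 the occupancy numbers of the remaining $r-1$ particles. That is, conditionally on $(X_1,\dots,X_n)=(x_1,\dots,x_n)$, for each $h$, with probability $x_h/r$ one has $X'_h=x_h-1$ and $X'_j=x_j$ for $j\ne h$. *)

theory Defs
  imports "HOL-Probability.Probability"
begin

text \<open>Vectors \<open>(x\<^sub>1,\<dots>,x\<^sub>n)\<close> are functions on \<open>{1..n}\<close>, extended by \<^const>\<open>undefined\<close> outside.\<close>

definition occupancies :: "nat \<Rightarrow> nat \<Rightarrow> (nat \<Rightarrow> nat) set" where
  "occupancies n r = {x \<in> {1..n} \<rightarrow>\<^sub>E UNIV. (\<Sum>j\<in>{1..n}. x j) = r}"

definition norm_const :: "(nat \<Rightarrow> real) \<Rightarrow> nat \<Rightarrow> nat \<Rightarrow> real" where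
  "norm_const a n r = (\<Sum>x\<in>occupancies n r. \<Prod>j\<in>{1..n}. a (x j))"

definition random_vector :: "'w measure \<Rightarrow> nat \<Rightarrow> ('w \<Rightarrow> nat \<Rightarrow> nat) \<Rightarrow> bool" where
  "random_vector M n X \<longleftrightarrow> X \<in> M \<rightarrow>\<^sub>M (\<Pi>\<^sub>M j\<in>{1..n}. count_space UNIV)"

text \<open>``With values in \<open>A\<^bsub>n,r\<^esub>\<close>'' is read almost surely, since the model is a statement about the
  law of \<open>X\<close> only.\<close>

definition occupancy_model ::
    "'w measure \<Rightarrow> (nat \<Rightarrow> real) \<Rightarrow> nat \<Rightarrow> nat \<Rightarrow> ('w \<Rightarrow> nat \<Rightarrow> nat) \<Rightarrow> bool" where
  "occupancy_model M a n r X \<longleftrightarrow>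
     random_vector M n X \<and>
     (AE \<omega> in M. X \<omega> \<in> occupancies n r) \<and>
     (\<forall>x\<in>occupancies n r.
        \<P>(\<omega> in M. X \<omega> = x) = (\<Prod>j\<in>{1..n}. a (x j)) / norm_const a n r)"

text \<open>\<open>drop_particle M n r X X'\<close>: the vector \<open>X'\<close> arises from \<open>X\<close> by dropping one of the \<open>r\<close>
  particles uniformly at random. Conditioning is restricted to events \<open>X = x\<close> of positive
  probability. Only cells with \<open>x h > 0\<close> are listed, because \<open>x h - 1\<close> truncates on \<^typ>\<open>nat\<close>;
  for \<open>x \<in> occupancies n r\<close> with \<open>r > 0\<close> their probabilities \<open>x h / r\<close> add up to 1, so the
  conditional law of \<open>X'\<close> given \<open>X = x\<close> is completely determined.\<close>

definition drop_particle ::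
    "'w measure \<Rightarrow> nat \<Rightarrow> nat \<Rightarrow> ('w \<Rightarrow> nat \<Rightarrow> nat) \<Rightarrow> ('w \<Rightarrow> nat \<Rightarrow> nat) \<Rightarrow> bool" where
  "drop_particle M n r X X' \<longleftrightarrow>
     random_vector M n X' \<and>
     (\<forall>x\<in>occupancies n r. \<P>(\<omega> in M. X \<omega> = x) > 0 \<longrightarrow>
        (\<forall>h\<in>{1..n}. x h > 0 \<longrightarrow>
           \<P>(\<omega> in M. X' \<omega> = x(h := x h - 1) \<bar> X \<omega> = x) = real (x h) / real r))"

end

theory Submission
  imports Defs
begin

text \<open>Writing \<open>y + e\<^sub>h\<close> for \<open>y\<close> with one particle added in cell \<open>h\<close>, the disjoint events
  \<open>X = y + e\<^sub>h\<close>, \<open>X' = y\<close> have total probability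
  \<open>\<Sum>\<^sub>h (y\<^sub>h + 1) / r \<cdot> \<Prod> a((y + e\<^sub>h)\<^sub>j) / C\<^bsub>n,r\<^esub>\<close>, which by hypothesis is \<open>\<Prod> a(y\<^sub>j) / C\<^bsub>n,r-1\<^esub>\<close>.
  These lower bounds for the probabilities of \<open>X' = y\<close> add up to 1, so they are all attained
  and \<open>X'\<close> lies in \<open>A\<^bsub>n,r-1\<^esub>\<close> almost surely. Transitions from other values of \<open>X\<close>
  therefore never need to be excluded.\<close>

text \<open>By disjointness the numbers \<open>prob (E y)\<close> sum to the probability of the
  union, which is at most 1 = \<open>sum p S\<close>. Termwise bounds between finite sums that agree
  leave no slack in any term, and the union has probability 1.\<close>

lemma (in prob_space) prob_eq_of_tight_lower_bounds:
  fixes E :: "'i \<Rightarrow> 'a set" and p :: "'i \<Rightarrow> real"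
  assumes S: "finite S" and E: "\<And>y. y \<in> S \<Longrightarrow> E y \<in> events"
    and disj: "disjoint_family_on E S"
    and lower: "\<And>y. y \<in> S \<Longrightarrow> p y \<le> prob (E y)"
    and total: "sum p S = 1"
  shows "\<And>y. y \<in> S \<Longrightarrow> prob (E y) = p y"
    and "AE \<omega> in M. \<omega> \<in> (\<Union>y\<in>S. E y)"
proof -
  have U: "prob (\<Union>y\<in>S. E y) = (\<Sum>y\<in>S. prob (E y))"
    using S E disj by (intro finite_measure_finite_Union) auto
  have "(\<Sum>y\<in>S. prob (E y)) \<le> sum p S"
    unfolding U[symmetric] total by simp
  moreover have "sum p S \<le> (\<Sum>y\<in>S. prob (E y))"
    by (intro sum_mono lower)
  ultimately have eq: "sum p S = (\<Sum>y\<in>S. prob (E y))"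
    by simp
  show "prob (E y) = p y" if "y \<in> S" for y
    using sum_mono_inv[OF eq lower that S] by simp
  have ev: "(\<Union>y\<in>S. E y) \<in> events"
    using S E by auto
  show "AE \<omega> in M. \<omega> \<in> (\<Union>y\<in>S. E y)"
    using U eq total prob_eq_1[OF ev] by simp
qed

text \<open>No cell holds more than all \<open>r\<close> particles. Finiteness matters because a sum
  over an infinite set defaults to 0, which would make \<open>norm_const\<close> vanish.\<close>

lemma finite_occupancies: "finite (occupancies n r)"
proof (rule finite_subset)
  show "occupancies n r \<subseteq> {1..n} \<rightarrow>\<^sub>E {..r}"
  proof
    fix x assume "x \<in> occupancies n r"
    then have x: "x \<in> {1..n} \<rightarrow>\<^sub>E UNIV" "(\<Sum>j\<in>{1..n}. x j) = r"
      by (auto simp: occupancies_def)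
    have "x j \<le> r" if "j \<in> {1..n}" for j
      unfolding x(2)[symmetric] using that by (intro member_le_sum) auto
    with x(1) show "x \<in> {1..n} \<rightarrow>\<^sub>E {..r}"
      by (auto simp: PiE_iff)
  qed
qed (simp add: finite_PiE)

lemma occupancies_nonempty:
  assumes "n \<ge> 1"
  shows "occupancies n r \<noteq> {}"
proof -
  \<comment> \<open>The witness puts all particles in cell 1, which exists since \<open>n\<close> is
    positive.\<close>
  have "(\<lambda>j\<in>{1..n}. if j = 1 then r else 0) \<in> occupancies n r"
    using assms by (simp add: occupancies_def)
  then show ?thesis by blast
qed

lemma norm_const_pos:
  assumes "n \<ge> 1" and "\<And>k. a k > 0"
  shows "norm_const a n r > 0"
  unfolding norm_const_def using assms
  by (intro sum_pos finite_occupancies occupancies_nonempty prod_pos) auto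

lemma sum_model_probs:
  assumes "n \<ge> 1" and "\<And>k. a k > 0"
  shows "(\<Sum>x\<in>occupancies n r. (\<Prod>j\<in>{1..n}. a (x j)) / norm_const a n r) = 1"
proof -
  have "norm_const a n r \<noteq> 0"
    using norm_const_pos[of n a r] assms by auto
  then show ?thesis
    by (simp add: sum_divide_distrib[symmetric] norm_const_def)
qed

lemma occupancies_add_particle:
  assumes y: "y \<in> occupancies n r" and h: "h \<in> {1..n}"
  shows "y(h := y h + 1) \<in> occupancies n (Suc r)"
proof -
  have "(\<Sum>j\<in>{1..n}. (y(h := y h + 1)) j) = (\<Sum>j\<in>{1..n}. y j + (if j = h then 1 else 0))"
    by (intro sum.cong) auto
  also have "\<dots> = Suc r"
    using y h by (simp add: sum.distrib occupancies_def)
  finally show ?thesis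
    using y h by (auto simp: occupancies_def PiE_iff extensional_def)
qed

text \<open>Only the factor at \<open>h\<close> changes; the resulting quotient is the one that
  occurs in the hypothesis on \<open>a\<close>.\<close>

lemma prod_add_particle:
  fixes a :: "nat \<Rightarrow> real"
  assumes "finite A" and "h \<in> A" and "a (y h) \<noteq> 0"
  shows "(\<Prod>j\<in>A. a ((y(h := y h + 1)) j)) = (\<Prod>j\<in>A. a (y j)) * (a (y h + 1) / a (y h))"
proof -
  have "(\<Prod>j\<in>A - {h}. a ((y(h := y h + 1)) j)) = (\<Prod>j\<in>A - {h}. a (y j))"
    by (intro prod.cong) auto
  then show ?thesis
    using assms by (simp add: prod.remove[of A h])
qed

text \<open>Since \<open>x\<close> is fixed to \<open>undefined\<close> outside
  \<open>{1..n}\<close>, the singleton \<open>{x}\<close> is a finite box and hence measurable in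
  the product space.\<close>

lemma random_vector_event:
  assumes X: "random_vector M n X" and x: "x \<in> occupancies n r"
  shows "{\<omega> \<in> space M. X \<omega> = x} \<in> sets M"
proof -
  have "x \<in> extensional {1..n}"
    using x by (auto simp: occupancies_def PiE_iff)
  then have "{x} = (\<Pi>\<^sub>E j\<in>{1..n}. {x j})"
    by (auto simp: PiE_singleton)
  also have "\<dots> \<in> sets (\<Pi>\<^sub>M j\<in>{1..n}. count_space UNIV)"
    by (intro sets_PiM_I_finite) auto
  finally have "X -` {x} \<inter> space M \<in> sets M"
    using X unfolding random_vector_def by (rule measurable_sets[rotated])
  also have "X -` {x} \<inter> space M = {\<omega> \<in> space M. X \<omega> = x}"
    by auto
  finally show ?thesis .
qed

theorem proposition6p6:
  fixes M :: "'w measure" and a :: "nat \<Rightarrow> real" and n r :: nat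
    and X X' :: "'w \<Rightarrow> nat \<Rightarrow> nat"
  assumes "prob_space M"
    and "n \<ge> 2" and "r \<ge> 1"
    and "\<And>k. a k > 0"
    and "occupancy_model M a n r X"
    and "\<And>x'. x' \<in> occupancies n (r - 1) \<Longrightarrow>
           norm_const a n (r - 1) / norm_const a n r *
             (\<Sum>h\<in>{1..n}. (real (x' h) + 1) / real r * (a (x' h + 1) / a (x' h))) = 1"
    and "drop_particle M n r X X'"
  shows "occupancy_model M a n (r - 1) X'"
proof -
  interpret prob_space M by fact
  have n: "n \<ge> 1" using \<open>n \<ge> 2\<close> by simp
  have apos: "a k \<noteq> 0" "a k > 0" for k using assms(4)[of k] by auto
  have X: "random_vector M n X"
    and PX: "\<And>x. x \<in> occupancies n r \<Longrightarrow>
      \<P>(\<omega> in M. X \<omega> = x) = (\<Prod>j\<in>{1..n}. a (x j)) / norm_const a n r"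
    using assms(5) by (auto simp: occupancy_model_def)
  have X': "random_vector M n X'"
    using assms(7) by (simp add: drop_particle_def)
  let ?S = "occupancies n (r - 1)"
  let ?p = "\<lambda>y. (\<Prod>j\<in>{1..n}. a (y j)) / norm_const a n (r - 1)"
  let ?E = "\<lambda>y. {\<omega> \<in> space M. X' \<omega> = y}"
  have C: "norm_const a n s > 0" for s
    using norm_const_pos[of n a s] n apos by blast
  have lower: "?p y \<le> prob (?E y)" if y: "y \<in> ?S" for y
  proof -
    let ?x = "\<lambda>h. y(h := y h + 1)"
    let ?F = "\<lambda>h. {\<omega> \<in> space M. X' \<omega> = y \<and> X \<omega> = ?x h}"
    have x: "?x h \<in> occupancies n r" if "h \<in> {1..n}" for h
      \<comment> \<open>Here \<open>r \<ge> 1\<close> ensures that \<open>Suc (r - 1)\<close> is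
        \<open>r\<close>.\<close>
      using occupancies_add_particle[OF y that] \<open>r \<ge> 1\<close> by simp
    have F: "?F h \<in> events" if "h \<in> {1..n}" for h
      using sets.Int[OF random_vector_event[OF X' y] random_vector_event[OF X x[OF that]]]
      by (simp add: Collect_conj_eq Int_assoc Int_left_commute)
    have PF: "prob (?F h) = (real (y h) + 1) / real r *
        ((\<Prod>j\<in>{1..n}. a (y j)) * (a (y h + 1) / a (y h)) / norm_const a n r)"
      if h: "h \<in> {1..n}" for h
    proof -
      have Px: "\<P>(\<omega> in M. X \<omega> = ?x h) =
          (\<Prod>j\<in>{1..n}. a (y j)) * (a (y h + 1) / a (y h)) / norm_const a n r"
        using PX[OF x[OF h]] prod_add_particle[of "{1..n}" h a y] h apos by simp
      \<comment> \<open>Dropping is specified only given events of positive probability; positivity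
        of \<open>a\<close> provides this.\<close>
      have pos: "\<P>(\<omega> in M. X \<omega> = ?x h) > 0"
        unfolding Px using apos C by (intro divide_pos_pos mult_pos_pos prod_pos) auto
      \<comment> \<open>Removing the added particle gives back \<open>y\<close>. Cell
        \<open>h\<close> holds \<open>y h + 1 > 0\<close> particles, so the subtraction does not
        truncate.\<close>
      have "\<P>(\<omega> in M. X' \<omega> = (?x h)(h := ?x h h - 1) \<bar> X \<omega> = ?x h)
          = real (?x h h) / real r"
        using assms(7)[unfolded drop_particle_def, THEN conjunct2, rule_format, OF x[OF h] pos h]
        by simp
      then have "\<P>(\<omega> in M. X' \<omega> = y \<bar> X \<omega> = ?x h) = (real (y h) + 1) / real r"
        by simp
      then show ?thesis
        using pos unfolding cond_prob_def Px[symmetric] by (simp add: field_simps)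
    qed
    \<comment> \<open>The factor inserted is the left side of the hypothesis, equal to 1; it trades
      the constant for \<open>r - 1\<close> for the one for \<open>r\<close>.\<close>
    have "?p y = ?p y * (norm_const a n (r - 1) / norm_const a n r *
        (\<Sum>h\<in>{1..n}. (real (y h) + 1) / real r * (a (y h + 1) / a (y h))))"
      by (simp only: assms(6)[OF y] mult_1_right)
    also have "\<dots> = (\<Prod>j\<in>{1..n}. a (y j)) / norm_const a n r *
        (\<Sum>h\<in>{1..n}. (real (y h) + 1) / real r * (a (y h + 1) / a (y h)))"
      using C[of "r - 1"] by simp
    also have "\<dots> = (\<Sum>h\<in>{1..n}. prob (?F h))"
      unfolding sum_distrib_left by (intro sum.cong refl) (simp only: PF, simp add: mult_ac)
    also have "\<dots> = prob (\<Union>h\<in>{1..n}. ?F h)"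
    proof (rule finite_measure_finite_Union[symmetric])
      \<comment> \<open>Different cells \<open>h\<close> prescribe different values of
        \<open>X\<close>, since adding a particle to \<open>y\<close> changes coordinate
        \<open>h\<close> only.\<close>
      show "disjoint_family_on ?F {1..n}"
        by (auto simp: disjoint_family_on_def fun_upd_def fun_eq_iff)
    qed (use F in auto)
    also have "\<dots> \<le> prob (?E y)"
      using random_vector_event[OF X' y] by (intro finite_measure_mono) auto
    finally show ?thesis .
  qed
  have disj: "disjoint_family_on ?E ?S"
    by (auto simp: disjoint_family_on_def)
  have E: "?E y \<in> events" if "y \<in> ?S" for y
    using random_vector_event[OF X' that] .
  have total: "sum ?p ?S = 1"
    using n assms(4) by (rule sum_model_probs)
  have "AE \<omega> in M. \<omega> \<in> (\<Union>y\<in>?S. ?E y)"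
    by (rule prob_eq_of_tight_lower_bounds(2)[OF finite_occupancies E disj lower total])
  then have "AE \<omega> in M. X' \<omega> \<in> ?S"
    by eventually_elim auto
  moreover have "prob (?E y) = ?p y" if "y \<in> ?S" for y
    by (rule prob_eq_of_tight_lower_bounds(1)[OF finite_occupancies E disj lower total that])
  ultimately show ?thesis
    using X' by (simp add: occupancy_model_def)
qed

end
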